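(* Let $X$ be a real normed space, let $\mathcal K\subset X$ be a co-radiant set, and let $K:=\operatorname{cone}(\mathcal K)$. Suppose that $K$ is solid. Then the following assertions are equivalent: (i) $\mathcal K$ is regular. (ii) There exist an inner approximating sequence of cones $(K_n)$ for $K$ and $n_0\in\mathbb N$ such that, for every $n\ge n_0$, $\rho_{\mathcal K}$ is bounded above on $S_X\cap K_n$.
   Context: $X$ is a real normed space, $S_X$ its unit sphere, $B_X^\circ$ its open unit ball, $\operatorname{bd}$ denotes boundary. A cone is a nonempty $C\subset X$ with $\alpha C\subset C$ for all $\alpha\ge 0$; cones are assumed nontrivial ($\{0_X\}\subsetneq C\subset X$) unless otherwise stated; a cone is solid if its interior is nonempty. $\operatorname{cone}(A):=\{\lambda a:\lambda\ge 0,\ a\in A\}$. Co-radiant set: $\mathcal K\subset X$ with $\lambda x\in\mathcal K$ for all $x\in\mathcal K$, $\lambda\ge 1$; co-radiant sets are assumed nonempty with $0_X\notin\mathcal K$. Norm-base: for $t>0$, $\mathcal K\cap tS_X$ is a norm-base of $\mathcal K$ if for every $x\in\mathcal K$ there exist $y\in\mathcal K\cap tS_X$ and $\lambda>0$ with $x=\lambda y$; $\mathcal K$ admits a norm-base if this holds for some $t>0$. Interior reductions: for a cone $K$ and $\varepsilon>0$, $K^{-\varepsilon}:=K\setminus\bigl(\operatorname{cone}((\operatorname{bd}K\cap S_X)+\varepsilon B_X^\circ)\setminus\{0_X\}\bigr)$ (a cone, possibly trivial). For co-radiant $\mathcal K$, $\mathcal K^{-\varepsilon}:=\mathcal K\cap(\operatorname{cone}(\mathcal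 K))^{-\varepsilon}$. $\mathcal K$ is regular if, for every $\varepsilon>0$ with $\mathcal K^{-\varepsilon}\neq\varnothing$, the set $\mathcal K^{-\varepsilon}$ admits a norm-base. Inner approximating sequence: a sequence $(K_n)$ of cones is an inner approximating sequence for a cone $K$ if (i) $K_n\subset K_{n+1}\subset K$ for every $n\in\mathbb N$, and (ii) for every $\varepsilon>0$ there is $n_\varepsilon\in\mathbb N$ with $K^{-\varepsilon}\subset K_n$ for all $n\ge n_\varepsilon$. Radial profile: $\rho_{\mathcal K}:S_X\to[0,+\infty]$, $\rho_{\mathcal K}(v):=\inf\{\lambda>0:\lambda v\in\mathcal K\}$ with $\inf\varnothing=+\infty$. "Bounded above" means bounded above by a finite constant. *)

theory Defs
  imports "HOL-Analysis.Analysis"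
begin

(* The cone generated by A is the library's "cone hull A"; by cone_hull_expl it equals
   {c *\<^sub>R x | c x. 0 \<le> c \<and> x \<in> A}, also for A = {} (where both are empty). *)

(* The library's predicate cone admits the empty set, and a nonempty cone contains 0.
   Only {0} is excluded here; the whole space counts as a nontrivial cone. *)
definition nontrivial_cone :: "'a::real_normed_vector set \<Rightarrow> bool"
  where "nontrivial_cone C \<longleftrightarrow> cone C \<and> C \<noteq> {} \<and> C \<noteq> {0}"

definition solid :: "'a::real_normed_vector set \<Rightarrow> bool"
  where "solid C \<longleftrightarrow> interior C \<noteq> {}"

definition co_radiant :: "'a::real_normed_vector set \<Rightarrow> bool"
  where "co_radiant A \<longleftrightarrow> A \<noteq> {} \<and> 0 \<notin> A \<and> (\<forall>x\<in>A. \<forall>c\<ge>1. c *\<^sub>R x \<in> A)"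

(* A \<inter> sphere 0 t is a norm-base of A. *)
definition norm_base_at :: "'a::real_normed_vector set \<Rightarrow> real \<Rightarrow> bool"
  where "norm_base_at A t \<longleftrightarrow> (\<forall>x\<in>A. \<exists>y\<in>A \<inter> sphere 0 t. \<exists>c>0. x = c *\<^sub>R y)"

definition admits_norm_base :: "'a::real_normed_vector set \<Rightarrow> bool"
  where "admits_norm_base A \<longleftrightarrow> (\<exists>t>0. norm_base_at A t)"

definition cone_reduction :: "'a::real_normed_vector set \<Rightarrow> real \<Rightarrow> 'a set"
  where "cone_reduction K \<epsilon> =
    K - (cone hull {b + \<epsilon> *\<^sub>R u | b u. b \<in> frontier K \<inter> sphere 0 1 \<and> u \<in> ball 0 1} - {0})"

definition co_radiant_reduction :: "'a::real_normed_vector set \<Rightarrow> real \<Rightarrow> 'a set"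
  where "co_radiant_reduction A \<epsilon> = A \<inter> cone_reduction (cone hull A) \<epsilon>"

definition regular :: "'a::real_normed_vector set \<Rightarrow> bool"
  where "regular A \<longleftrightarrow>
    (\<forall>\<epsilon>>0. co_radiant_reduction A \<epsilon> \<noteq> {} \<longrightarrow> admits_norm_base (co_radiant_reduction A \<epsilon>))"

definition inner_approximating_sequence ::
    "(nat \<Rightarrow> 'a::real_normed_vector set) \<Rightarrow> 'a set \<Rightarrow> bool"
  where "inner_approximating_sequence C K \<longleftrightarrow>
    (\<forall>n. nontrivial_cone (C n)) \<and>
    (\<forall>n. C n \<subseteq> C (Suc n) \<and> C (Suc n) \<subseteq> K) \<and>
    (\<forall>\<epsilon>>0. \<exists>N. \<forall>n\<ge>N. cone_reduction K \<epsilon> \<subseteq> C n)"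

(* Only the values at unit vectors are meant; the infimum of {} in ennreal is \<infinity>. *)
definition radial_profile :: "'a::real_normed_vector set \<Rightarrow> 'a \<Rightarrow> ennreal"
  where "radial_profile A v = Inf {ennreal l | l. 0 < l \<and> l *\<^sub>R v \<in> A}"

end

theory Submission
  imports Defs
begin

text \<open>
  Write \<open>K\<close> for the cone generated by \<open>A\<close>. For a unit vector \<open>v\<close> and \<open>t > 0\<close>,
  the radial profile at \<open>v\<close> is at most \<open>t\<close> if \<open>t *\<^sub>R v \<in> A\<close>; conversely, since \<open>A\<close> is closed under
  enlarging its elements, a radial profile strictly below \<open>t\<close> forces \<open>t *\<^sub>R v \<in> A\<close>.
  Hence, for any cone \<open>C \<subseteq> K\<close>, the part of \<open>A\<close> inside \<open>C\<close> has a norm-base exactly when the radial profile is bounded on the directions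
  of \<open>C\<close> (\<open>radial_profile_le_norm_base\<close>, \<open>norm_base_at_if_radial_profile_less\<close>). Applied to the
  cones \<open>C = cone_reduction K \<epsilon>\<close>, this says that \<open>A\<close> is regular iff its radial profile is bounded
  on the directions of every reduction of \<open>K\<close>.

  The equivalence follows, because the reductions are cofinal among inner approximating sequences:
  each reduction lies in a late member of any such sequence, and conversely the reductions for
  a decreasing null sequence of small enough parameters form such a sequence themselves. Solidity
  of \<open>K\<close> is what makes the second claim work: an interior direction keeps a positive
  distance from the unit boundary vectors, so it survives in the reductions for small \<open>\<epsilon>\<close>, which are therefore nontrivial cones
  (\<open>interior_direction_in_cone_reduction\<close>).
\<close>

section \<open>Interior reductions of a cone\<close>

text \<open>
  Describing the removed points by the rays through them, rather than by a cone hull, makes it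
  visible that the removed set is a union of open rays and that it grows with \<open>\<epsilon>\<close>.
\<close>

lemma mem_cone_reduction_iff:
  fixes x :: "'a::real_normed_vector"
  assumes "\<epsilon> > 0"
  shows "x \<in> cone_reduction K \<epsilon> \<longleftrightarrow>
    x \<in> K \<and> (x = 0 \<or> (\<forall>b\<in>frontier K \<inter> sphere 0 1. \<forall>s>0. \<epsilon> \<le> dist b (s *\<^sub>R x)))"
proof -
  let ?N = "{b + \<epsilon> *\<^sub>R u | b u. b \<in> frontier K \<inter> sphere 0 1 \<and> u \<in> ball 0 1}"
  have "x \<in> cone hull ?N \<longleftrightarrow> (\<exists>b\<in>frontier K \<inter> sphere 0 1. \<exists>s>0. dist b (s *\<^sub>R x) < \<epsilon>)"
    if "x \<noteq> 0"
  proof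
    assume "x \<in> cone hull ?N"
    then obtain c b u where c: "c \<ge> 0" "x = c *\<^sub>R (b + \<epsilon> *\<^sub>R u)"
      and b: "b \<in> frontier K \<inter> sphere 0 1" and u: "norm u < 1"
      by (auto simp: cone_hull_expl)
    with that have "c > 0" by (cases "c = 0") auto
    have "dist b ((1 / c) *\<^sub>R x) = \<epsilon> * norm u"
      using \<open>c > 0\<close> assms by (simp add: c dist_norm)
    also have "\<dots> < \<epsilon>" using assms u by simp
    finally show "\<exists>b\<in>frontier K \<inter> sphere 0 1. \<exists>s>0. dist b (s *\<^sub>R x) < \<epsilon>"
      using b \<open>c > 0\<close> by (meson zero_less_divide_1_iff)
  next
    assume "\<exists>b\<in>frontier K \<inter> sphere 0 1. \<exists>s>0. dist b (s *\<^sub>R x) < \<epsilon>"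
    then obtain b s where b: "b \<in> frontier K \<inter> sphere 0 1" and s: "s > 0"
      and d: "dist b (s *\<^sub>R x) < \<epsilon>" by blast
    define u where "u = (1 / \<epsilon>) *\<^sub>R (s *\<^sub>R x - b)"
    have "norm u < 1"
      using d assms by (simp add: u_def dist_norm norm_minus_commute)
    moreover have su: "s *\<^sub>R x = b + \<epsilon> *\<^sub>R u"
      using assms by (simp add: u_def)
    ultimately have "s *\<^sub>R x \<in> ?N"
      using b by auto
    moreover have "x = (1 / s) *\<^sub>R (s *\<^sub>R x)"
      using s by simp
    ultimately show "x \<in> cone hull ?N"
      unfolding cone_hull_expl using s
      by (metis (mono_tags, lifting) mem_Collect_eq less_imp_le zero_less_divide_1_iff)
  qed
  then show ?thesis
    unfolding cone_reduction_def by (cases "x = 0") (simp, simp only: Diff_iff, force simp: not_less)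
qed

lemma cone_cone_reduction:
  fixes K :: "'a::real_normed_vector set"
  assumes "cone K" "\<epsilon> > 0"
  shows "cone (cone_reduction K \<epsilon>)"
  unfolding cone_def
proof (intro ballI allI impI)
  fix x and c :: real
  assume x: "x \<in> cone_reduction K \<epsilon>" and "c \<ge> 0"
  show "c *\<^sub>R x \<in> cone_reduction K \<epsilon>"
  proof (cases "c = 0 \<or> x = 0")
    case True
    then show ?thesis
      using x assms by (auto simp: mem_cone_reduction_iff dest: mem_cone[where c = 0])
  next
    case False
    with \<open>c \<ge> 0\<close> have "c > 0" by simp
    then show ?thesis
      using x assms False
      by (auto simp: mem_cone_reduction_iff mem_cone)
  qed
qed

lemma cone_reduction_subset: "cone_reduction K \<epsilon> \<subseteq> K"
  by (auto simp: cone_reduction_def)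

lemma cone_reduction_antimono:
  fixes K :: "'a::real_normed_vector set"
  assumes "0 < \<delta>" "\<delta> \<le> \<epsilon>"
  shows "cone_reduction K \<epsilon> \<subseteq> cone_reduction K \<delta>"
  using assms by (force simp: mem_cone_reduction_iff)

lemma interior_cone_scaleR:
  fixes K :: "'a::real_normed_vector set"
  assumes "cone K" "x \<in> interior K" "c > 0"
  shows "c *\<^sub>R x \<in> interior K"
proof (rule interiorI)
  show "open ((*\<^sub>R) c ` interior K)"
    using assms(3) by (intro open_scaling) auto
  show "c *\<^sub>R x \<in> (*\<^sub>R) c ` interior K"
    using assms(2) by blast
  show "(*\<^sub>R) c ` interior K \<subseteq> K"
    using assms(1,3) interior_subset by (auto intro!: mem_cone)
qed

lemma frontier_cone_scaleR:
  fixes K :: "'a::real_normed_vector set"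
  assumes "cone K" "b \<in> frontier K" "c > 0"
  shows "c *\<^sub>R b \<in> frontier K"
proof -
  have "c *\<^sub>R b \<in> closure ((*\<^sub>R) c ` K)"
    using assms(2) closure_scaleR[of c K] by (auto simp: frontier_def)
  also have "\<dots> \<subseteq> closure K"
    using assms(1,3) by (intro closure_mono) (auto intro!: mem_cone)
  finally have "c *\<^sub>R b \<in> closure K" .
  moreover have "c *\<^sub>R b \<notin> interior K"
    using interior_cone_scaleR[OF assms(1), of "c *\<^sub>R b" "1 / c"] assms(2,3)
    by (auto simp: frontier_def)
  ultimately show ?thesis
    by (simp add: frontier_def)
qed

text \<open>
  If the unit vector \<open>x\<close> is the centre of a ball of radius \<open>r\<close> inside \<open>K\<close>, then \<open>s *\<^sub>R x\<close> has distance
  at least \<open>s * r\<close> from the boundary. This is useless for small \<open>s\<close>, but there \<open>s *\<^sub>R x\<close> has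
  distance at least \<open>1 - s\<close> from the whole unit sphere.
\<close>

lemma interior_direction_in_cone_reduction:
  fixes K :: "'a::real_normed_vector set"
  assumes "cone K" "norm x = 1" "x \<in> interior K"
  obtains \<epsilon> where "\<epsilon> > 0" "x \<in> cone_reduction K \<epsilon>"
proof -
  obtain r where r: "r > 0" "ball x r \<subseteq> interior K"
    using assms(3) open_interior open_contains_ball by blast
  \<comment> \<open>The two lower bounds \<open>s * r\<close> and \<open>1 - s\<close> coincide for \<open>s = 1 / (1 + r)\<close>.\<close>
  define \<epsilon> where "\<epsilon> = r / (1 + r)"
  have "\<epsilon> > 0" using r by (simp add: \<epsilon>_def)
  have "\<epsilon> \<le> dist b (s *\<^sub>R x)" if b: "b \<in> frontier K" "norm b = 1" and s: "s > 0" for b s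
  proof -
    have "(1 / s) *\<^sub>R b \<in> frontier K"
      using frontier_cone_scaleR[OF assms(1) b(1)] s by simp
    then have "(1 / s) *\<^sub>R b \<notin> ball x r"
      using r(2) by (auto simp: frontier_def)
    then have "r \<le> norm ((1 / s) *\<^sub>R (b - s *\<^sub>R x))"
      using s by (simp add: dist_norm norm_minus_commute scaleR_right_diff_distrib)
    then have "r \<le> norm (b - s *\<^sub>R x) / s"
      using s by (simp only: norm_scaleR) simp
    then have 1: "s * r \<le> dist b (s *\<^sub>R x)"
      using s by (simp add: dist_norm pos_le_divide_eq mult.commute)
    have 2: "1 - s \<le> dist b (s *\<^sub>R x)"
      using norm_triangle_ineq2[of b "s *\<^sub>R x"] b s assms(2) by (simp add: dist_norm)
    have "r = s * r + r * (1 - s)"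
      by (simp add: algebra_simps)
    also have "\<dots> \<le> (1 + r) * dist b (s *\<^sub>R x)"
      using 1 mult_left_mono[OF 2, of r] r by (simp add: algebra_simps)
    finally show ?thesis
      using r by (simp add: \<epsilon>_def pos_divide_le_eq mult.commute)
  qed
  then have "x \<in> cone_reduction K \<epsilon>"
    using \<open>\<epsilon> > 0\<close> assms(3) interior_subset by (auto simp: mem_cone_reduction_iff)
  with \<open>\<epsilon> > 0\<close> show thesis by (rule that)
qed

text \<open>
  The interior of \<open>K\<close> contains a nonzero vector to normalize: the open set \<open>{0}\<close> is the
  only alternative, and it would force the whole space to be zero and \<open>K\<close> to be trivial.
\<close>

lemma nontrivial_cone_reduction_if_solid:
  fixes K :: "'a::real_normed_vector set"
  assumes "nontrivial_cone K" "solid K"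
  obtains \<epsilon> where "\<epsilon> > 0" "nontrivial_cone (cone_reduction K \<epsilon>)"
proof -
  have K: "cone K" and "\<exists>k\<in>K. k \<noteq> 0"
    using assms(1) by (auto simp: nontrivial_cone_def)
  then obtain k :: 'a where k: "k \<noteq> 0" by blast
  obtain y where "y \<in> interior K" "y \<noteq> 0"
  proof (cases "interior K = {0}")
    case True
    then obtain r where "r > 0" "ball 0 r \<subseteq> interior K"
      by (metis insertI1 open_contains_ball open_interior)
    moreover have "(r / (2 * norm k)) *\<^sub>R k \<in> ball 0 r" "(r / (2 * norm k)) *\<^sub>R k \<noteq> 0"
      using k \<open>r > 0\<close> by auto
    ultimately show ?thesis using that by blast
  next
    case False
    then show ?thesis using that assms(2) by (auto simp: solid_def)
  qed
  then have "(1 / norm y) *\<^sub>R y \<in> interior K" "norm ((1 / norm y) *\<^sub>R y) = 1"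
    using interior_cone_scaleR[OF K] by simp_all
  then obtain \<epsilon> where "\<epsilon> > 0" "(1 / norm y) *\<^sub>R y \<in> cone_reduction K \<epsilon>"
    using interior_direction_in_cone_reduction[OF K] by blast
  then show thesis
    using that[of \<epsilon>] \<open>y \<noteq> 0\<close> cone_cone_reduction[OF K, of \<epsilon>] by (force simp: nontrivial_cone_def)
qed

lemma inner_approximating_sequence_cone_reduction:
  fixes K :: "'a::real_normed_vector set"
  assumes "\<epsilon>\<^sub>0 > 0" "nontrivial_cone (cone_reduction K \<epsilon>\<^sub>0)" "cone K"
  shows "inner_approximating_sequence (\<lambda>n. cone_reduction K (\<epsilon>\<^sub>0 / real (Suc n))) K"
  unfolding inner_approximating_sequence_def
proof (intro conjI allI impI)
  let ?e = "\<lambda>n. \<epsilon>\<^sub>0 / real (Suc n)"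
  have pos: "?e n > 0" for n
    using assms(1) by simp
  have mono: "cone_reduction K (?e m) \<subseteq> cone_reduction K (?e n)" if "m \<le> n" for m n
    using that assms(1) by (intro cone_reduction_antimono pos divide_left_mono) auto
  show "nontrivial_cone (cone_reduction K (?e n))" for n
    using mono[of 0 n] assms(2) cone_cone_reduction[OF assms(3) pos, of n]
    by (auto simp: nontrivial_cone_def)
  show "cone_reduction K (?e n) \<subseteq> cone_reduction K (?e (Suc n))" for n
    by (rule mono) simp
  show "cone_reduction K (?e (Suc n)) \<subseteq> K" for n
    by (rule cone_reduction_subset)
  show "\<exists>N. \<forall>n\<ge>N. cone_reduction K \<epsilon> \<subseteq> cone_reduction K (?e n)" if "\<epsilon> > 0" for \<epsilon>
  proof -
    obtain N where N: "\<epsilon>\<^sub>0 / \<epsilon> < real N"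
      using reals_Archimedean2 by blast
    have "?e N \<le> \<epsilon>"
      using N that by (simp add: field_simps)
    then have "cone_reduction K \<epsilon> \<subseteq> cone_reduction K (?e N)"
      by (intro cone_reduction_antimono pos)
    then show ?thesis using mono by blast
  qed
qed

section \<open>Norm-bases and the radial profile\<close>

lemma nontrivial_cone_cone_hull_co_radiant:
  assumes "co_radiant A"
  shows "nontrivial_cone (cone hull A)"
  using assms hull_subset[of A cone]
  by (auto simp: nontrivial_cone_def co_radiant_def cone_cone_hull)

text \<open>
  A direction of \<open>C\<close> is the direction of some element of \<open>A \<inter> C\<close>, hence of an element of the
  norm-base.
\<close>

lemma radial_profile_le_norm_base:
  fixes A :: "'a::real_normed_vector set"
  assumes "cone C" "C \<subseteq> cone hull A" "t > 0" "norm_base_at (A \<inter> C) t"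
    and v: "v \<in> sphere 0 1 \<inter> C"
  shows "radial_profile A v \<le> ennreal t"
proof -
  obtain c a where c: "c \<ge> 0" "a \<in> A" "v = c *\<^sub>R a"
    using v assms(2) by (auto simp: cone_hull_expl)
  with v have "c > 0" by (cases "c = 0") auto
  then have "a = (1 / c) *\<^sub>R v" by (simp add: c)
  then have "a \<in> A \<inter> C"
    using c v \<open>c > 0\<close> mem_cone[OF assms(1), of v "1 / c"] by simp
  then obtain y d where y: "y \<in> A" "norm y = t" "d > 0" "a = d *\<^sub>R y"
    using assms(4) unfolding norm_base_at_def by (metis IntD1 IntD2 mem_sphere_0)
  have "c * d * t = 1"
    using v y c \<open>c > 0\<close> by (simp add: c y)
  then have "t *\<^sub>R v = y"
    by (simp add: c y mult.commute mult.left_commute)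
  then show ?thesis
    unfolding radial_profile_def using y assms(3) by (intro Inf_lower) auto
qed

lemma scaleR_mem_if_radial_profile_less:
  assumes "co_radiant A" "radial_profile A v < ennreal t"
  shows "t *\<^sub>R v \<in> A"
proof -
  obtain l where l: "0 < l" "l *\<^sub>R v \<in> A" "ennreal l < ennreal t"
    using assms(2) by (auto simp: radial_profile_def Inf_less_iff)
  then have "l \<le> t"
    by (meson ennreal_lessI le_less_linear less_asym order.strict_trans1 ennreal_leI leD)
  then have "(t / l) *\<^sub>R (l *\<^sub>R v) \<in> A"
    using assms(1) l unfolding co_radiant_def by (meson le_divide_eq_1_pos)
  then show ?thesis using l by simp
qed

lemma norm_base_at_if_radial_profile_less:
  assumes "co_radiant A" "cone C" "t > 0"
    and "\<And>v. v \<in> sphere 0 1 \<inter> C \<Longrightarrow> radial_profile A v < ennreal t"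
  shows "norm_base_at (A \<inter> C) t"
  unfolding norm_base_at_def
proof
  fix x assume x: "x \<in> A \<inter> C"
  then have "x \<noteq> 0" using assms(1) by (auto simp: co_radiant_def)
  define v where "v = (1 / norm x) *\<^sub>R x"
  have v: "v \<in> sphere 0 1 \<inter> C"
    using x \<open>x \<noteq> 0\<close> mem_cone[OF assms(2), of x "1 / norm x"] by (simp add: v_def)
  have "t *\<^sub>R v \<in> A"
    using scaleR_mem_if_radial_profile_less[OF assms(1) assms(4)[OF v]] .
  moreover have "t *\<^sub>R v \<in> C"
    using v assms(2,3) by (simp add: mem_cone)
  moreover have "norm (t *\<^sub>R v) = t" "x = (norm x / t) *\<^sub>R (t *\<^sub>R v)" "norm x / t > 0"
    using v \<open>x \<noteq> 0\<close> assms(3) by (auto simp: v_def)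
  ultimately show "\<exists>y\<in>A \<inter> C \<inter> sphere 0 t. \<exists>c>0. x = c *\<^sub>R y"
    by (intro bexI[of _ "t *\<^sub>R v"] exI[of _ "norm x / t"]) auto
qed

section \<open>Regularity and inner approximation\<close>

theorem proposition5p10:
  fixes A :: "'a::real_normed_vector set"
  assumes "co_radiant A"
    and "solid (cone hull A)"
  shows "regular A \<longleftrightarrow>
    (\<exists>(C :: nat \<Rightarrow> 'a set) n0. inner_approximating_sequence C (cone hull A) \<and>
      (\<forall>n\<ge>n0. \<exists>M<\<infinity>. \<forall>v\<in>sphere 0 1 \<inter> C n. radial_profile A v \<le> M))"
proof
  let ?K = "cone hull A"
  have K: "cone ?K" by (rule cone_cone_hull)
  assume reg: "regular A"
  obtain \<epsilon>\<^sub>0 where e0: "\<epsilon>\<^sub>0 > 0" "nontrivial_cone (cone_reduction ?K \<epsilon>\<^sub>0)"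
    using nontrivial_cone_reduction_if_solid nontrivial_cone_cone_hull_co_radiant assms by blast
  let ?C = "\<lambda>n. cone_reduction ?K (\<epsilon>\<^sub>0 / real (Suc n))"
  have "\<exists>M<\<infinity>. \<forall>v\<in>sphere 0 1 \<inter> ?C n. radial_profile A v \<le> M" for n
  proof -
    let ?\<epsilon> = "\<epsilon>\<^sub>0 / real (Suc n)"
    have pos: "?\<epsilon> > 0" using e0 by simp
    \<comment> \<open>Regularity speaks of nonempty reductions only; the empty set has norm-bases at all levels.\<close>
    have "admits_norm_base (co_radiant_reduction A ?\<epsilon>)"
    proof (cases "co_radiant_reduction A ?\<epsilon> = {}")
      case True
      show ?thesis
        unfolding True admits_norm_base_def norm_base_at_def by (intro exI[of _ 1]) simp
    next
      case False
      then show ?thesis using reg pos unfolding regular_def by blast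
    qed
    then obtain t where t: "t > 0" "norm_base_at (A \<inter> ?C n) t"
      unfolding admits_norm_base_def co_radiant_reduction_def by blast
    then have "\<forall>v\<in>sphere 0 1 \<inter> ?C n. radial_profile A v \<le> ennreal t"
      using radial_profile_le_norm_base[OF cone_cone_reduction[OF K pos] cone_reduction_subset]
      by blast
    then show ?thesis
      by (intro exI[of _ "ennreal t"]) simp
  qed
  then show "\<exists>C n0. inner_approximating_sequence C ?K \<and>
      (\<forall>n\<ge>n0. \<exists>M<\<infinity>. \<forall>v\<in>sphere 0 1 \<inter> C n. radial_profile A v \<le> M)"
    using inner_approximating_sequence_cone_reduction[OF e0 K] by blast
next
  let ?K = "cone hull A"
  assume "\<exists>C n0. inner_approximating_sequence C ?K \<and>
      (\<forall>n\<ge>n0. \<exists>M<\<infinity>. \<forall>v\<in>sphere 0 1 \<inter> C n. radial_profile A v \<le> M)"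
  then obtain C n0 where C: "inner_approximating_sequence C ?K"
    and bdd: "\<And>n. n \<ge> n0 \<Longrightarrow> \<exists>M<\<infinity>. \<forall>v\<in>sphere 0 1 \<inter> C n. radial_profile A v \<le> M"
    by blast
  show "regular A"
    unfolding regular_def
  proof (intro allI impI)
    fix \<epsilon> :: real assume "\<epsilon> > 0"
    then obtain N where N: "\<And>n. n \<ge> N \<Longrightarrow> cone_reduction ?K \<epsilon> \<subseteq> C n"
      using C unfolding inner_approximating_sequence_def by blast
    obtain M where M: "M < \<infinity>" "\<forall>v\<in>sphere 0 1 \<inter> C (max n0 N). radial_profile A v \<le> M"
      using bdd[of "max n0 N"] by auto
    \<comment> \<open>The level must exceed \<open>M\<close> strictly: an infimum equal to the level need not be attained.\<close>
    define t where "t = enn2real M + 1"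
    have "t > 0" by (simp add: t_def add_nonneg_pos)
    have "M = ennreal (enn2real M)" using M(1) by simp
    also have "\<dots> < ennreal t" by (simp add: t_def ennreal_less_iff)
    finally have "M < ennreal t" .
    then have "radial_profile A v < ennreal t" if "v \<in> sphere 0 1 \<inter> cone_reduction ?K \<epsilon>" for v
      using that N[of "max n0 N"] M(2) by (meson IntD1 IntD2 IntI le_less_trans max.cobounded2 subsetD)
    then have "norm_base_at (A \<inter> cone_reduction ?K \<epsilon>) t"
      using norm_base_at_if_radial_profile_less[OF assms(1) cone_cone_reduction] cone_cone_hull
        \<open>\<epsilon> > 0\<close> \<open>t > 0\<close> by blast
    then show "admits_norm_base (co_radiant_reduction A \<epsilon>)"
      using \<open>t > 0\<close> by (auto simp: admits_norm_base_def co_radiant_reduction_def)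
  qed
qed

end
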